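(* Let $(\Omega,\mathcal{F},\mathbb{P})$ be a probability space equipped with a filtration $(\mathcal{F}_t)_{t\ge 0}$ such that $\mathcal{F}_0$ contains all $\mathbb{P}$-null sets. Let $(h_t)_{t\ge 0}$ be a real-valued progressively measurable process with sample paths continuous at $0$. Assume that for all $t\ge 0$, $|h_t|\le \xi$ for some random variable $\xi$ (not depending on $t$) satisfying $\mathbb{E}\xi<\infty$. Then $$\sup_{\tau\in\mathfrak{T}}\mathbb{E}h_\tau=\sup_{F\in\mathfrak{F}}\mathbb{E}\int_0^\infty h_t\,dF_t<\infty,$$ where $\mathfrak{T}$ is the set of finite stopping times and $\mathfrak{F}$ is the set of randomized stopping processes defined in the context.
   Context: $\mathfrak{T}$ denotes the set of finite stopping times with respect to $(\mathcal{F}_t)_{t\ge0}$. $\mathfrak{F}$ denotes the set of all processes $F=(F_t)_{t\ge 0}$ which are $(\mathcal{F}_t)_{t\ge 0}$-adapted, right-continuous and increasing (i.e. non-decreasing in $t$), and such that for every $\omega\in\Omega$, $F_0(\omega)=0$ and $\lim_{t\to\infty}F_t(\omega)=1$. The integral $\int_0^\infty h_t\,dF_t$ is the pathwise Lebesgue–Stieltjes integral. *)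

theory Defs
  imports "HOL-Probability.Probability"
begin

text \<open>
  Time is the half-line \<open>{0..}\<close> of type \<^typ>\<open>real\<close>. The library's \<^const>\<open>filtration\<close> and
  \<^const>\<open>stopping_time\<close> range over the whole index type, so a family \<open>\<F>\<close> indexed by
  \<open>t \<ge> 0\<close> is passed to them as \<open>\<lambda>t. \<F> (max 0 t)\<close>. Values of filtrations and processes at
  negative times are therefore irrelevant throughout.
\<close>

definition progressively_measurable ::
    "(real \<Rightarrow> 'a measure) \<Rightarrow> (real \<Rightarrow> 'a \<Rightarrow> real) \<Rightarrow> bool" where
  "progressively_measurable \<F> h \<longleftrightarrow>
     (\<forall>t\<ge>0. (\<lambda>(s, \<omega>). h s \<omega>) \<in> borel_measurable (restrict_space borel {0..t} \<Otimes>\<^sub>M \<F> t))"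

text \<open>Finiteness of a stopping time is built into the value type \<^typ>\<open>real\<close>.\<close>

definition finite_stopping_times ::
    "'a measure \<Rightarrow> (real \<Rightarrow> 'a measure) \<Rightarrow> ('a \<Rightarrow> real) set" where
  "finite_stopping_times M \<F> =
     {\<tau>. (\<forall>\<omega>\<in>space M. 0 \<le> \<tau> \<omega>) \<and> stopping_time (\<lambda>t. \<F> (max 0 t)) \<tau>}"

definition randomized_stopping_processes ::
    "'a measure \<Rightarrow> (real \<Rightarrow> 'a measure) \<Rightarrow> (real \<Rightarrow> 'a \<Rightarrow> real) set" where
  "randomized_stopping_processes M \<F> =
     {F. (\<forall>t\<ge>0. F t \<in> borel_measurable (\<F> t)) \<and>
         (\<forall>\<omega>\<in>space M.
            (\<forall>t\<ge>0. continuous (at_right t) (\<lambda>s. F s \<omega>)) \<and>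
            mono_on {0..} (\<lambda>t. F t \<omega>) \<and>
            F 0 \<omega> = 0 \<and>
            ((\<lambda>t. F t \<omega>) \<longlongrightarrow> 1) at_top)}"

text \<open>
  The Lebesgue--Stieltjes integral of \<open>f\<close> over \<open>{0..}\<close> against a right-continuous
  non-decreasing \<open>g\<close> on \<open>{0..}\<close>. Extending \<open>g\<close> to the left by \<open>g 0\<close> means that no mass is
  put at \<open>0\<close>; for \<open>g 0 = 0\<close> this agrees with the convention that \<open>g\<close> vanishes on the
  negative half-line.
\<close>

definition stieltjes_integral :: "(real \<Rightarrow> real) \<Rightarrow> (real \<Rightarrow> real) \<Rightarrow> real" where
  "stieltjes_integral f g = (LINT t:{0..}|interval_measure (\<lambda>t. g (max 0 t)). f t)"

end

theory Submission
  imports Defs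
begin

text \<open>
  A process \<open>F\<close> in \<^const>\<open>randomized_stopping_processes\<close> is a mixture of stopping times. For
  \<open>0 < u < 1\<close> let \<open>T\<^sub>u\<close> be the first time at which \<open>F\<close> reaches the level \<open>u\<close>, that is the
  \<open>u\<close>-quantile of the distribution function \<open>t \<mapsto> F\<^sub>t\<close>. Since \<open>T\<^sub>u \<le> t\<close> holds exactly when
  \<open>u \<le> F\<^sub>t\<close>, each \<open>T\<^sub>u\<close> is a finite stopping time (\<open>quantile_stopping_time\<close>). The image of the
  uniform distribution on \<open>(0, 1)\<close> under \<open>u \<mapsto> T\<^sub>u\<close> is the Stieltjes measure \<open>dF\<close>, so the
  pathwise integral of \<open>h\<close> against \<open>dF\<close> is the integral of \<open>h\<close> at time \<open>T\<^sub>u\<close> over \<open>u\<close>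
  (\<open>stieltjes_integral_eq_quantile\<close>). By Fubini the value of \<open>F\<close> is an average of the values of
  the stopping times \<open>T\<^sub>u\<close> (\<open>expected_stieltjes_integral_eq\<close>), and an average does not exceed
  the supremum.

  Conversely, a stopping time \<open>\<tau>\<close> corresponds to the process that jumps from 0 to 1 at \<open>\<tau>\<close>.
  This process must start at 0, which fails where \<open>\<tau> = 0\<close>. Therefore \<open>\<tau>\<close> is replaced by
  \<open>max \<tau> (1 / n)\<close>, which gives an admissible process with a value that tends to that of \<open>\<tau>\<close>,
  by continuity of \<open>h\<close> at time 0 and dominated convergence
  (\<open>expectation_delayed_stopping_tendsto\<close>).

  Both suprema are bounded by the expectation of the dominating variable \<open>\<xi>\<close>.
\<close>

section \<open>Distribution functions on the half-line and their quantiles\<close>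

definition half_line_cdf :: "(real \<Rightarrow> real) \<Rightarrow> bool" where
  "half_line_cdf g \<longleftrightarrow>
     (\<forall>t\<ge>0. continuous (at_right t) g) \<and> mono_on {0..} g \<and> g 0 = 0 \<and> (g \<longlongrightarrow> 1) at_top"

text \<open>
  The truncation \<open>max 0 x\<close> is the extension by \<open>g 0\<close> that occurs in \<^const>\<open>stieltjes_integral\<close>;
  with it the infimum is the pseudo-inverse studied in \<^locale>\<open>right_continuous_mono\<close>.
\<close>

definition quantile :: "(real \<Rightarrow> real) \<Rightarrow> real \<Rightarrow> real" where
  "quantile g u = Inf {x. u \<le> g (max 0 x)}"

lemma right_continuous_mono_half_line_cdf:
  assumes "half_line_cdf g"
  shows "right_continuous_mono (\<lambda>x. g (max 0 x)) 0 1"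
proof
  have g: "\<And>t. 0 \<le> t \<Longrightarrow> continuous (at_right t) g" "mono_on {0..} g" "g 0 = 0" "(g \<longlongrightarrow> 1) at_top"
    using assms by (auto simp: half_line_cdf_def)
  show "mono (\<lambda>x. g (max 0 x))"
    by (intro monoI mono_onD[OF g(2)]) auto
  show "((\<lambda>x. g (max 0 x)) \<longlongrightarrow> 0) at_bot"
    using g(3) by (intro tendsto_eventually eventually_at_bot_linorderI[of 0]) auto
  show "((\<lambda>x. g (max 0 x)) \<longlongrightarrow> 1) at_top"
    by (rule Lim_transform_eventually[OF g(4)]) (auto intro!: eventually_at_top_linorderI[of 0])
  show "continuous (at_right x) (\<lambda>x. g (max 0 x))" for x
  proof (cases "0 \<le> x")
    case True
    have "(g \<longlongrightarrow> g x) (at_right x)"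
      using g(1)[OF True] by (simp add: continuous_within)
    then have "((\<lambda>y. g (max 0 y)) \<longlongrightarrow> g x) (at_right x)"
      by (rule Lim_transform_eventually)
        (use True in \<open>auto simp: eventually_at_right_field intro!: exI[of _ "x + 1"]\<close>)
    then show ?thesis
      using True by (simp add: continuous_within)
  next
    case False
    have "((\<lambda>y. g (max 0 y)) \<longlongrightarrow> g 0) (at_right x)"
      by (rule tendsto_eventually)
        (use False in \<open>auto simp: eventually_at_right_field intro!: exI[of _ 0]\<close>)
    then show ?thesis
      using False by (simp add: continuous_within)
  qed
qed

lemma quantile_le_iff:
  assumes "half_line_cdf g" "0 < u" "u < 1"
  shows "quantile g u \<le> x \<longleftrightarrow> u \<le> g (max 0 x)"
  unfolding quantile_def
  by (rule right_continuous_mono.pseudoinverse[OF right_continuous_mono_half_line_cdf, symmetric]) fact+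

lemma quantile_nonneg:
  assumes "half_line_cdf g" "0 < u" "u < 1"
  shows "0 \<le> quantile g u"
proof (rule ccontr)
  assume "\<not> 0 \<le> quantile g u"
  then have "u \<le> g (max 0 (quantile g u))"
    using quantile_le_iff[OF assms, of "quantile g u"] by simp
  moreover have "max 0 (quantile g u) = 0"
    using \<open>\<not> 0 \<le> quantile g u\<close> by simp
  moreover have "g 0 = 0"
    using assms(1) by (simp add: half_line_cdf_def)
  ultimately show False
    using \<open>0 < u\<close> by simp
qed

abbreviation unit_uniform :: "real measure" where
  "unit_uniform \<equiv> restrict_space lborel {0<..<1}"

lemma prob_space_unit_uniform: "prob_space unit_uniform"
  by (rule prob_spaceI) (simp add: emeasure_restrict_space space_restrict_space)

text \<open>
  This is inverse transform sampling: the quantile function carries the uniform distribution to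
  the measure with distribution function \<open>g\<close>. All quantiles of positive levels are nonnegative,
  so restricting the integral to \<open>{0..}\<close> loses no mass.
\<close>

lemma stieltjes_integral_eq_quantile:
  assumes g: "half_line_cdf g"
    and f[measurable]: "(\<lambda>t. f (max 0 t)) \<in> borel_measurable borel"
  shows "stieltjes_integral f g = (\<integral>u. f (quantile g u) \<partial>unit_uniform)"
proof -
  let ?G = "\<lambda>x. g (max 0 x)"
  interpret G: right_continuous_mono ?G 0 1
    by (rule right_continuous_mono_half_line_cdf[OF g])
  have cdf_eq: "cdf (interval_measure ?G) = ?G"
    by (rule cdf_interval_measure[OF monoD[OF G.mono] G.cont G.bot])
  interpret cdf_distribution "interval_measure ?G"
    unfolding cdf_distribution_def
    by (rule real_distribution_interval_measure[OF monoD[OF G.mono] G.cont G.bot G.top])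
  have distr: "distr unit_uniform borel (quantile g) = interval_measure ?G"
    using distr_I_eq_M unfolding cdf_eq quantile_def[abs_def] .
  have [measurable]: "quantile g \<in> borel_measurable unit_uniform"
    unfolding measurable_cong_sets[OF sets_restrict_space_cong[OF sets_lborel] refl]
    using measurable_CI unfolding cdf_eq quantile_def[abs_def] .
  have "stieltjes_integral f g =
      (\<integral>t. indicator {0..} t * f (max 0 t) \<partial>distr unit_uniform borel (quantile g))"
    unfolding stieltjes_integral_def set_lebesgue_integral_def distr
    by (intro Bochner_Integration.integral_cong) (auto simp: indicator_def)
  also have "\<dots> = (\<integral>u. indicator {0..} (quantile g u) * f (max 0 (quantile g u)) \<partial>unit_uniform)"
    by (rule integral_distr) measurable
  also have "\<dots> = (\<integral>u. f (quantile g u) \<partial>unit_uniform)"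
    by (intro Bochner_Integration.integral_cong)
      (auto simp: space_restrict_space quantile_nonneg[OF g])
  finally show ?thesis .
qed

lemma half_line_cdf_step: "0 < c \<Longrightarrow> half_line_cdf (\<lambda>t. if c \<le> t then 1 else 0)"
  unfolding half_line_cdf_def
proof (intro conjI allI impI)
  show "((\<lambda>t. if c \<le> t then 1 else 0 :: real) \<longlongrightarrow> 1) at_top"
    by (intro tendsto_eventually eventually_at_top_linorderI[of c]) auto
  fix t :: real
  show "continuous (at_right t) (\<lambda>t. if c \<le> t then 1 else 0 :: real)"
    unfolding continuous_within
    by (rule tendsto_eventually)
      (auto simp: eventually_at_right_field intro!: exI[of _ "if c \<le> t then t + 1 else c"])
qed (auto simp: mono_on_def)

text \<open>
  A unit jump at \<open>c\<close> yields the Dirac measure at \<open>c\<close>, because all its quantiles equal \<open>c\<close>.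
\<close>

lemma stieltjes_integral_step:
  assumes c: "0 < c" and f: "(\<lambda>t. f (max 0 t)) \<in> borel_measurable borel"
  shows "stieltjes_integral f (\<lambda>t. if c \<le> t then 1 else 0) = f c"
proof -
  interpret prob_space unit_uniform
    by (rule prob_space_unit_uniform)
  have "quantile (\<lambda>t. if c \<le> t then 1 else 0) u = c" if "u \<in> {0<..<1}" for u
  proof -
    have "{x. u \<le> (if c \<le> max 0 x then 1 else 0)} = {c..}"
      using that c by (auto split: if_splits)
    then show ?thesis
      by (simp add: quantile_def)
  qed
  then have "(\<integral>u. f (quantile (\<lambda>t. if c \<le> t then 1 else 0) u) \<partial>unit_uniform) = (\<integral>u. f c \<partial>unit_uniform)"
    by (intro Bochner_Integration.integral_cong) (auto simp: space_restrict_space)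
  then show ?thesis
    using stieltjes_integral_eq_quantile[OF half_line_cdf_step[OF c] f] prob_space by simp
qed

section \<open>Measurability of evaluated processes\<close>

text \<open>
  Progressive measurability only concerns bounded time intervals, so the process is first clipped
  at time \<open>n\<close>. At a fixed time \<open>s\<close> the clipping has no effect once \<open>n \<ge> s\<close>.
\<close>

lemma borel_measurable_progressive:
  assumes prog: "progressively_measurable \<F> h"
    and sub: "\<And>t. 0 \<le> t \<Longrightarrow> subalgebra M (\<F> t)"
  shows "(\<lambda>(s, \<omega>). h (max 0 s) \<omega>) \<in> borel_measurable (borel \<Otimes>\<^sub>M M)"
proof (rule borel_measurable_LIMSEQ_real)
  fix n :: nat
  have clip: "(\<lambda>(s, \<omega>). (min (real n) (max 0 s), \<omega>))
      \<in> borel \<Otimes>\<^sub>M M \<rightarrow>\<^sub>M restrict_space borel {0..real n} \<Otimes>\<^sub>M \<F> n"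
  proof (rule measurable_pair)
    show "fst \<circ> (\<lambda>(s, \<omega>). (min (real n) (max 0 s), \<omega>))
        \<in> borel \<Otimes>\<^sub>M M \<rightarrow>\<^sub>M restrict_space borel {0..real n}"
      by (rule measurable_restrict_space2) (auto simp: comp_def split_beta)
    have "(\<lambda>x. x) \<in> M \<rightarrow>\<^sub>M \<F> n"
      by (rule measurable_from_subalg[OF sub[of "real n"]]) auto
    from measurable_compose[OF measurable_snd this]
    show "snd \<circ> (\<lambda>(s, \<omega>). (min (real n) (max 0 s), \<omega>)) \<in> borel \<Otimes>\<^sub>M M \<rightarrow>\<^sub>M \<F> n"
      by (simp add: comp_def split_beta)
  qed
  have "(\<lambda>(s, \<omega>). h s \<omega>) \<in> borel_measurable (restrict_space borel {0..real n} \<Otimes>\<^sub>M \<F> n)"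
    using prog by (simp add: progressively_measurable_def)
  from measurable_compose[OF clip this]
  show "(\<lambda>(s, \<omega>). h (min (real n) (max 0 s)) \<omega>) \<in> borel_measurable (borel \<Otimes>\<^sub>M M)"
    by (simp add: split_beta)
next
  fix z :: "real \<times> 'a"
  obtain s \<omega> where z: "z = (s, \<omega>)" by force
  show "(\<lambda>n. (\<lambda>(s, \<omega>). h (min (real n) (max 0 s)) \<omega>) z) \<longlonglongrightarrow> (\<lambda>(s, \<omega>). h (max 0 s) \<omega>) z"
    unfolding z
  proof (rule tendsto_eventually, rule eventually_sequentiallyI)
    fix n assume "nat \<lceil>max 0 s\<rceil> \<le> n"
    then have "max 0 s \<le> real n"
      by (meson of_nat_mono order_trans real_nat_ceiling_ge)
    then show "(\<lambda>(s, \<omega>). h (min (real n) (max 0 s)) \<omega>) (s, \<omega>) = (\<lambda>(s, \<omega>). h (max 0 s) \<omega>) (s, \<omega>)"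
      by (simp add: min_absorb2 del: max.bounded_iff)
  qed
qed

lemma finite_stopping_time_borel_measurable:
  assumes "\<tau> \<in> finite_stopping_times M \<F>"
    and sub: "\<And>t. 0 \<le> t \<Longrightarrow> subalgebra M (\<F> t)"
  shows "\<tau> \<in> borel_measurable M"
proof (rule borel_measurableI_le)
  fix t :: real
  have "Measurable.pred (\<F> (max 0 t)) (\<lambda>\<omega>. \<tau> \<omega> \<le> t)"
    using assms(1) by (simp add: finite_stopping_times_def stopping_time_def)
  then have "Measurable.pred M (\<lambda>\<omega>. \<tau> \<omega> \<le> t)"
    by (rule measurable_from_subalg[OF sub, rotated]) simp
  then show "{\<omega> \<in> space M. \<tau> \<omega> \<le> t} \<in> sets M"
    by (simp add: pred_def)
qed

lemma half_line_cdf_randomized_stopping_process: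
  assumes "F \<in> randomized_stopping_processes M \<F>" "\<omega> \<in> space M"
  shows "half_line_cdf (\<lambda>t. F t \<omega>)"
  using assms by (simp add: randomized_stopping_processes_def half_line_cdf_def)

text \<open>
  Defining the quantile by \<open>u \<le> F\<^sub>t\<close> instead of \<open>u < F\<^sub>t\<close> is what makes it a stopping time for a
  filtration that is not right-continuous: right-continuity of the paths turns
  \<open>{quantile \<le> t}\<close> into the event \<open>{u \<le> F\<^sub>t}\<close>, which looks no further than time \<open>t\<close>.
  The quantile is finite because \<open>u < 1\<close>.
\<close>

lemma quantile_stopping_time:
  assumes F: "F \<in> randomized_stopping_processes M \<F>"
    and sub: "\<And>t. 0 \<le> t \<Longrightarrow> subalgebra M (\<F> t)"
    and u: "0 < u" "u < 1"
  shows "(\<lambda>\<omega>. quantile (\<lambda>t. F t \<omega>) u) \<in> finite_stopping_times M \<F>"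
proof -
  note cdf = half_line_cdf_randomized_stopping_process[OF F]
  have "Measurable.pred (\<F> (max 0 t)) (\<lambda>\<omega>. quantile (\<lambda>t. F t \<omega>) u \<le> t)" for t
  proof -
    have [measurable]: "F (max 0 t) \<in> borel_measurable (\<F> (max 0 t))"
      using F by (simp add: randomized_stopping_processes_def)
    have "space (\<F> (max 0 t)) = space M"
      using sub[of "max 0 t"] by (simp add: subalgebra_def)
    then have "Measurable.pred (\<F> (max 0 t)) (\<lambda>\<omega>. quantile (\<lambda>t. F t \<omega>) u \<le> t) \<longleftrightarrow>
        Measurable.pred (\<F> (max 0 t)) (\<lambda>\<omega>. u \<le> F (max 0 t) \<omega>)"
      by (intro measurable_cong) (simp add: quantile_le_iff[OF cdf u])
    then show ?thesis
      by simp
  qed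
  then show ?thesis
    using quantile_nonneg[OF cdf u] by (auto simp: finite_stopping_times_def stopping_time_def)
qed

text \<open>
  Capping \<open>\<tau>\<close> from below by a positive constant \<open>c\<close> makes the jump process vanish at time 0.
\<close>

lemma step_randomized_stopping_process:
  assumes \<tau>: "\<tau> \<in> finite_stopping_times M \<F>" and c: "0 < c"
    and sub: "\<And>t. 0 \<le> t \<Longrightarrow> subalgebra M (\<F> t)"
  shows "(\<lambda>t \<omega>. if max (\<tau> \<omega>) c \<le> t then 1 else 0) \<in> randomized_stopping_processes M \<F>"
proof -
  have "(\<lambda>\<omega>. if max (\<tau> \<omega>) c \<le> t then 1 else 0 :: real) \<in> borel_measurable (\<F> t)" if "0 \<le> t" for t
  proof -
    have [measurable]: "Measurable.pred (\<F> t) (\<lambda>\<omega>. \<tau> \<omega> \<le> t)"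
      using \<tau> that by (auto simp: finite_stopping_times_def stopping_time_def max_def dest!: spec[of _ t])
    show ?thesis
      by (simp add: max.bounded_iff)
  qed
  moreover have "half_line_cdf (\<lambda>t. if max (\<tau> \<omega>) c \<le> t then 1 else 0)" for \<omega>
    by (rule half_line_cdf_step) (use c in auto)
  ultimately show ?thesis
    unfolding randomized_stopping_processes_def half_line_cdf_def by blast
qed

section \<open>Comparison of the two optimal values\<close>

text \<open>
  Joint measurability in the level and the outcome, needed for Fubini, follows from the same
  equivalence of \<open>quantile \<le> x\<close> and \<open>u \<le> F\<^sub>x\<close> as the stopping property.
\<close>

lemma quantile_process_borel_measurable:
  assumes F: "F \<in> randomized_stopping_processes M \<F>"
    and sub: "\<And>t. 0 \<le> t \<Longrightarrow> subalgebra M (\<F> t)"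
  shows "(\<lambda>(u, \<omega>). quantile (\<lambda>t. F t \<omega>) u) \<in> borel_measurable (unit_uniform \<Otimes>\<^sub>M M)"
proof (rule borel_measurableI_le)
  fix x :: real
  note cdf = half_line_cdf_randomized_stopping_process[OF F]
  have [measurable]: "F (max 0 x) \<in> borel_measurable M"
    by (rule measurable_from_subalg[OF sub[of "max 0 x"]])
      (use F in \<open>auto simp: randomized_stopping_processes_def\<close>)
  have "{z \<in> space (unit_uniform \<Otimes>\<^sub>M M). (\<lambda>(u, \<omega>). quantile (\<lambda>t. F t \<omega>) u) z \<le> x} =
      {z \<in> space (unit_uniform \<Otimes>\<^sub>M M). fst z \<le> F (max 0 x) (snd z)}"
    by (auto simp: space_pair_measure space_restrict_space quantile_le_iff[OF cdf])
  also have "\<dots> \<in> sets (unit_uniform \<Otimes>\<^sub>M M)"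
  proof -
    have [measurable]: "fst \<in> borel_measurable (unit_uniform \<Otimes>\<^sub>M M)"
      by (rule measurable_compose[OF measurable_fst, of "\<lambda>x. x"]) (auto intro: measurable_restrict_space1)
    show ?thesis by measurable
  qed
  finally show "{z \<in> space (unit_uniform \<Otimes>\<^sub>M M). (\<lambda>(u, \<omega>). quantile (\<lambda>t. F t \<omega>) u) z \<le> x}
      \<in> sets (unit_uniform \<Otimes>\<^sub>M M)" .
qed

text \<open>
  \<open>J u\<close> is the value of stopping when \<open>F\<close> reaches the level \<open>u\<close>. The value of \<open>F\<close> is its average
  over the levels: apply the quantile formula on each path and exchange the two integrals, which
  the bound \<open>\<xi>\<close> permits.
\<close>

lemma expected_stieltjes_integral_eq:
  assumes "prob_space M"
    and F: "F \<in> randomized_stopping_processes M \<F>"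
    and sub: "\<And>t. 0 \<le> t \<Longrightarrow> subalgebra M (\<F> t)"
    and h[measurable]: "(\<lambda>(s, \<omega>). h (max 0 s) \<omega>) \<in> borel_measurable (borel \<Otimes>\<^sub>M M)"
    and \<xi>: "integrable M \<xi>"
    and bound: "\<And>t \<omega>. 0 \<le> t \<Longrightarrow> \<omega> \<in> space M \<Longrightarrow> \<bar>h t \<omega>\<bar> \<le> \<xi> \<omega>"
  defines "J \<equiv> \<lambda>u. \<integral>\<omega>. h (quantile (\<lambda>t. F t \<omega>) u) \<omega> \<partial>M"
  shows "integrable unit_uniform J"
    and "(\<integral>\<omega>. stieltjes_integral (\<lambda>t. h t \<omega>) (\<lambda>t. F t \<omega>) \<partial>M) = (\<integral>u. J u \<partial>unit_uniform)"
proof -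
  interpret M: prob_space M by fact
  interpret U: prob_space unit_uniform by (rule prob_space_unit_uniform)
  interpret P: pair_prob_space unit_uniform M ..
  note cdf = half_line_cdf_randomized_stopping_process[OF F]
  have nn: "0 \<le> quantile (\<lambda>t. F t \<omega>) u" if "u \<in> space unit_uniform" "\<omega> \<in> space M" for u \<omega>
    using that quantile_nonneg[OF cdf] by (simp add: space_restrict_space)
  note Q[measurable] = quantile_process_borel_measurable[OF F sub]
  have meas: "(\<lambda>z. h (max 0 (quantile (\<lambda>t. F t (snd z)) (fst z))) (snd z))
      \<in> borel_measurable (unit_uniform \<Otimes>\<^sub>M M)"
    using measurable_compose[OF measurable_Pair[OF Q measurable_snd] h] by (simp add: split_beta)
  have \<xi>': "integrable (unit_uniform \<Otimes>\<^sub>M M) (\<lambda>z. \<xi> (snd z))"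
    by (rule P.Fubini_integrable) (use \<xi> in auto)
  have "integrable (unit_uniform \<Otimes>\<^sub>M M) (\<lambda>z. h (max 0 (quantile (\<lambda>t. F t (snd z)) (fst z))) (snd z))"
    by (rule Bochner_Integration.integrable_bound[OF \<xi>' meas])
      (auto intro!: AE_I2 order_trans[OF bound] simp: space_pair_measure)
  then have int: "integrable (unit_uniform \<Otimes>\<^sub>M M) (\<lambda>(u, \<omega>). h (quantile (\<lambda>t. F t \<omega>) u) \<omega>)"
    by (rule Bochner_Integration.integrable_cong[THEN iffD1, rotated 2])
      (auto simp: space_pair_measure nn max_absorb2)
  show "integrable unit_uniform J"
    unfolding J_def using P.integrable_fst'[OF int] by simp
  have "stieltjes_integral (\<lambda>t. h t \<omega>) (\<lambda>t. F t \<omega>) =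
      (\<integral>u. h (quantile (\<lambda>t. F t \<omega>) u) \<omega> \<partial>unit_uniform)" if \<omega>: "\<omega> \<in> space M" for \<omega>
  proof (rule stieltjes_integral_eq_quantile[OF cdf[OF \<omega>]])
    show "(\<lambda>t. h (max 0 t) \<omega>) \<in> borel_measurable borel"
      using measurable_compose[OF measurable_Pair2'[OF \<omega>] h] by simp
  qed
  then have "(\<integral>\<omega>. stieltjes_integral (\<lambda>t. h t \<omega>) (\<lambda>t. F t \<omega>) \<partial>M) =
      (\<integral>\<omega>. (\<integral>u. h (quantile (\<lambda>t. F t \<omega>) u) \<omega> \<partial>unit_uniform) \<partial>M)"
    by (intro Bochner_Integration.integral_cong) auto
  also have "\<dots> = (\<integral>u. J u \<partial>unit_uniform)"
    unfolding J_def by (rule P.Fubini_integral[OF int])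
  finally show "(\<integral>\<omega>. stieltjes_integral (\<lambda>t. h t \<omega>) (\<lambda>t. F t \<omega>) \<partial>M) = (\<integral>u. J u \<partial>unit_uniform)" .
qed

lemma borel_measurable_stopped:
  assumes h: "(\<lambda>(s, \<omega>). h (max 0 s) \<omega>) \<in> borel_measurable (borel \<Otimes>\<^sub>M M)"
    and \<sigma>: "\<sigma> \<in> borel_measurable M" "\<And>\<omega>. \<omega> \<in> space M \<Longrightarrow> 0 \<le> \<sigma> \<omega>"
  shows "(\<lambda>\<omega>. h (\<sigma> \<omega>) \<omega>) \<in> borel_measurable M"
proof -
  have "(\<lambda>\<omega>. h (max 0 (\<sigma> \<omega>)) \<omega>) \<in> borel_measurable M"
    using measurable_compose[OF measurable_Pair[OF \<sigma>(1) measurable_ident] h] by (simp add: id_def)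
  then show ?thesis
    by (rule measurable_cong[THEN iffD1, rotated]) (use \<sigma>(2) in \<open>auto simp: max_absorb2\<close>)
qed

text \<open>
  The delayed time differs from \<open>\<tau>\<close> for large \<open>n\<close> only where \<open>\<tau> = 0\<close>. Hence continuity at 0 alone
  gives pointwise convergence, even though \<open>h\<close> may jump at later times.
\<close>

lemma expectation_delayed_stopping_tendsto:
  fixes h :: "real \<Rightarrow> 'a \<Rightarrow> real"
  assumes h: "(\<lambda>(s, \<omega>). h (max 0 s) \<omega>) \<in> borel_measurable (borel \<Otimes>\<^sub>M M)"
    and cont: "\<And>\<omega>. \<omega> \<in> space M \<Longrightarrow> continuous (at 0 within {0..}) (\<lambda>t. h t \<omega>)"
    and \<xi>: "integrable M \<xi>"
    and bound: "\<And>t \<omega>. 0 \<le> t \<Longrightarrow> \<omega> \<in> space M \<Longrightarrow> \<bar>h t \<omega>\<bar> \<le> \<xi> \<omega>"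
    and \<tau>[measurable]: "\<tau> \<in> borel_measurable M" and nn: "\<And>\<omega>. \<omega> \<in> space M \<Longrightarrow> 0 \<le> \<tau> \<omega>"
  shows "(\<lambda>n. \<integral>\<omega>. h (max (\<tau> \<omega>) (1 / Suc n)) \<omega> \<partial>M) \<longlonglongrightarrow> (\<integral>\<omega>. h (\<tau> \<omega>) \<omega> \<partial>M)"
proof (rule integral_dominated_convergence[where w = \<xi>])
  show "integrable M \<xi>" by fact
  show "(\<lambda>\<omega>. h (\<tau> \<omega>) \<omega>) \<in> borel_measurable M"
    by (rule borel_measurable_stopped[OF h \<tau> nn])
  show "(\<lambda>\<omega>. h (max (\<tau> \<omega>) (1 / Suc n)) \<omega>) \<in> borel_measurable M" for n
    by (rule borel_measurable_stopped[OF h]) (auto simp: le_max_iff_disj nn)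
  show "AE \<omega> in M. norm (h (max (\<tau> \<omega>) (1 / Suc n)) \<omega>) \<le> \<xi> \<omega>" for n
    by (auto intro!: AE_I2 bound simp: le_max_iff_disj nn)
  show "AE \<omega> in M. (\<lambda>n. h (max (\<tau> \<omega>) (1 / Suc n)) \<omega>) \<longlonglongrightarrow> h (\<tau> \<omega>) \<omega>"
  proof (rule AE_I2)
    fix \<omega> assume \<omega>: "\<omega> \<in> space M"
    show "(\<lambda>n. h (max (\<tau> \<omega>) (1 / Suc n)) \<omega>) \<longlonglongrightarrow> h (\<tau> \<omega>) \<omega>"
    proof (cases "\<tau> \<omega> = 0")
      case True
      have "filterlim (\<lambda>n. 1 / real (Suc n)) (at 0 within {0..}) sequentially"
        using LIMSEQ_Suc[OF lim_1_over_n] by (auto simp: filterlim_at)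
      moreover have "((\<lambda>t. h t \<omega>) \<longlongrightarrow> h 0 \<omega>) (at 0 within {0..})"
        using cont[OF \<omega>] by (simp add: continuous_within)
      ultimately have "(\<lambda>n. h (1 / real (Suc n)) \<omega>) \<longlonglongrightarrow> h 0 \<omega>"
        by (rule filterlim_compose[rotated])
      then show ?thesis
        using True by (simp add: max_absorb2)
    next
      case False
      then have "0 < \<tau> \<omega>" using nn[OF \<omega>] by simp
      then have "eventually (\<lambda>n. 1 / Suc n < \<tau> \<omega>) sequentially"
        using LIMSEQ_Suc[OF lim_1_over_n] by (rule order_tendstoD(2)[rotated])
      then show ?thesis
        by (intro tendsto_eventually) (auto elim!: eventually_mono simp: max_absorb1)
    qed
  qed
qed

theorem theorem2p1:
  fixes M :: "'a measure"
    and \<F> :: "real \<Rightarrow> 'a measure"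
    and h :: "real \<Rightarrow> 'a \<Rightarrow> real"
    and \<xi> :: "'a \<Rightarrow> real"
  assumes "prob_space M"
    and "filtration (space M) (\<lambda>t. \<F> (max 0 t))"
    and "\<And>t. 0 \<le> t \<Longrightarrow> subalgebra M (\<F> t)"
    and "null_sets M \<subseteq> sets (\<F> 0)"
    and "progressively_measurable \<F> h"
    and "\<And>\<omega>. \<omega> \<in> space M \<Longrightarrow> continuous (at 0 within {0..}) (\<lambda>t. h t \<omega>)"
    and "integrable M \<xi>"
    and "\<And>t \<omega>. 0 \<le> t \<Longrightarrow> \<omega> \<in> space M \<Longrightarrow> \<bar>h t \<omega>\<bar> \<le> \<xi> \<omega>"
  shows "(SUP \<tau>\<in>finite_stopping_times M \<F>. ereal (\<integral>\<omega>. h (\<tau> \<omega>) \<omega> \<partial>M)) =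
           (SUP F\<in>randomized_stopping_processes M \<F>.
              ereal (\<integral>\<omega>. stieltjes_integral (\<lambda>t. h t \<omega>) (\<lambda>t. F t \<omega>) \<partial>M)) \<and>
         (SUP F\<in>randomized_stopping_processes M \<F>.
              ereal (\<integral>\<omega>. stieltjes_integral (\<lambda>t. h t \<omega>) (\<lambda>t. F t \<omega>) \<partial>M)) < \<infinity>"
proof -
  note sub = assms(3) and \<xi> = assms(7) and bound = assms(8)
  interpret M: prob_space M by fact
  interpret U: prob_space unit_uniform by (rule prob_space_unit_uniform)
  note h = borel_measurable_progressive[OF assms(5) sub]
  let ?V = "\<lambda>\<tau>. \<integral>\<omega>. h (\<tau> \<omega>) \<omega> \<partial>M"
  let ?W = "\<lambda>F. \<integral>\<omega>. stieltjes_integral (\<lambda>t. h t \<omega>) (\<lambda>t. F t \<omega>) \<partial>M"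
  let ?S = "SUP \<tau>\<in>finite_stopping_times M \<F>. ereal (?V \<tau>)"
  let ?R = "SUP F\<in>randomized_stopping_processes M \<F>. ereal (?W F)"
  have V_le: "?V \<tau> \<le> (\<integral>\<omega>. \<xi> \<omega> \<partial>M)" if \<tau>: "\<tau> \<in> finite_stopping_times M \<F>" for \<tau>
  proof (rule integral_mono)
    have nn: "\<And>\<omega>. \<omega> \<in> space M \<Longrightarrow> 0 \<le> \<tau> \<omega>"
      using \<tau> by (simp add: finite_stopping_times_def)
    have "(\<lambda>\<omega>. h (\<tau> \<omega>) \<omega>) \<in> borel_measurable M"
      by (rule borel_measurable_stopped[OF h finite_stopping_time_borel_measurable[OF \<tau> sub] nn])
    then show "integrable M (\<lambda>\<omega>. h (\<tau> \<omega>) \<omega>)"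
      by (rule Bochner_Integration.integrable_bound[OF \<xi>])
        (auto intro!: AE_I2 order_trans[OF bound] nn)
    show "h (\<tau> \<omega>) \<omega> \<le> \<xi> \<omega>" if "\<omega> \<in> space M" for \<omega>
      using bound[OF nn[OF that] that] by simp
  qed (rule \<xi>)
  then have S_le: "?S \<le> ereal (\<integral>\<omega>. \<xi> \<omega> \<partial>M)"
    by (intro SUP_least) simp
  have "?R \<le> ?S"
  proof (rule SUP_least)
    fix F assume F: "F \<in> randomized_stopping_processes M \<F>"
    note W = expected_stieltjes_integral_eq[where h = h, OF assms(1) F sub h \<xi> bound]
    have le: "ereal (\<integral>\<omega>. h (quantile (\<lambda>t. F t \<omega>) u) \<omega> \<partial>M) \<le> ?S" if "u \<in> {0<..<1}" for u
      by (rule SUP_upper2[OF quantile_stopping_time[OF F sub]]) (use that in auto)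
    \<comment> \<open>The level \<open>1/2\<close> is an arbitrary choice; its quantile bounds the supremum away from \<open>- \<infinity>\<close>.\<close>
    from le[of "1/2"] S_le obtain s where s: "?S = ereal s"
      by (cases ?S) auto
    have "AE u in unit_uniform. (\<integral>\<omega>. h (quantile (\<lambda>t. F t \<omega>) u) \<omega> \<partial>M) \<le> s"
      using le unfolding s by (intro AE_I2) (auto simp: space_restrict_space)
    from U.integral_le_const[OF W(1) this] have "?W F \<le> s"
      by (subst W(2))
    then show "ereal (?W F) \<le> ?S"
      by (simp add: s)
  qed
  moreover have "?S \<le> ?R"
  proof (rule SUP_least)
    fix \<tau> assume \<tau>: "\<tau> \<in> finite_stopping_times M \<F>"
    have nn: "\<And>\<omega>. \<omega> \<in> space M \<Longrightarrow> 0 \<le> \<tau> \<omega>"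
      using \<tau> by (simp add: finite_stopping_times_def)
    have delayed_le: "ereal (?V (\<lambda>\<omega>. max (\<tau> \<omega>) (1 / Suc n))) \<le> ?R" for n
    proof (rule SUP_upper2[OF step_randomized_stopping_process[OF \<tau> _ sub, of "1 / Suc n"]])
      have "stieltjes_integral (\<lambda>t. h t \<omega>) (\<lambda>t. if max (\<tau> \<omega>) (1 / Suc n) \<le> t then 1 else 0) =
          h (max (\<tau> \<omega>) (1 / Suc n)) \<omega>" if "\<omega> \<in> space M" for \<omega>
        using measurable_compose[OF measurable_Pair2'[OF that] h]
        by (intro stieltjes_integral_step) (auto simp: less_max_iff_disj)
      then have "?W (\<lambda>t \<omega>. if max (\<tau> \<omega>) (1 / Suc n) \<le> t then 1 else 0) =
          ?V (\<lambda>\<omega>. max (\<tau> \<omega>) (1 / Suc n))"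
        by (intro Bochner_Integration.integral_cong) auto
      then show "ereal (?V (\<lambda>\<omega>. max (\<tau> \<omega>) (1 / Suc n))) \<le>
          ereal (?W (\<lambda>t \<omega>. if max (\<tau> \<omega>) (1 / Suc n) \<le> t then 1 else 0))"
        by simp
    qed simp_all
    have lim: "(\<lambda>n. ereal (?V (\<lambda>\<omega>. max (\<tau> \<omega>) (1 / Suc n)))) \<longlonglongrightarrow> ereal (?V \<tau>)"
      using expectation_delayed_stopping_tendsto[OF h assms(6) \<xi> bound
          finite_stopping_time_borel_measurable[OF \<tau> sub] nn]
      by simp
    show "ereal (?V \<tau>) \<le> ?R"
      by (rule LIMSEQ_le_const2[OF lim]) (use delayed_le in blast)
  qed
  ultimately have "?S = ?R"
    by (rule antisym[rotated])
  with S_le show ?thesis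
    by (auto simp: less_top[symmetric])
qed

end
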